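(* For every $n\ge0$, $$\widetilde{Q}_n(x_1,x_2,y_1,y_2,u_1,u_2,v_1,v_2,\mathbf{w})=Q^{(1)}_n(x_1,x_2,y_1,y_2,u_1,u_2,v_1,v_2,\mathbf{w}),$$ where $$\widetilde{Q}_n(x_1,x_2,\widetilde{y}_1,y_2,u_1,u_2,\widetilde{v}_1,v_2,\mathbf{w})=\sum_{\sigma\in\mathfrak{S}_n} x_1^{\mathrm{eareccpeak}(\sigma)}x_2^{\mathrm{eareccdfall}(\sigma)}\widetilde{y}_1^{\mathrm{minval}(\sigma)}y_2^{\mathrm{ereccdrise}(\sigma)}u_1^{\mathrm{nrcpeak}(\sigma)}u_2^{\mathrm{nrcdfall}(\sigma)}\widetilde{v}_1^{\mathrm{nminval}(\sigma)}v_2^{\mathrm{nrcdrise}(\sigma)}\mathbf{w}^{\mathbf{fix}(\sigma)}$$ and $$Q^{(1)}_n(x_1,x_2,y_1,y_2,u_1,u_2,v_1,v_2,\mathbf{w})=\sum_{\sigma\in\mathfrak{S}_n} x_1^{\mathrm{eareccpeak}(\sigma)}x_2^{\mathrm{eareccdfall}(\sigma)}y_1^{\mathrm{ereccval}(\sigma)}y_2^{\mathrm{ereccdrise}(\sigma)}u_1^{\mathrm{nrcpeak}(\sigma)}u_2^{\mathrm{nrcdfall}(\sigma)}v_1^{\mathrm{nrcval}(\sigma)}v_2^{\mathrm{nrcdrise}(\sigma)}\mathbf{w}^{\mathbf{fix}(\sigma)},$$ with $\mathbf{w}^{\mathbf{fix}(\sigma)}=\prod_{i\ \text{fixed point of}\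 \sigma}w_{\mathrm{psnest}(i,\sigma)}$.
   Context: $\mathfrak{S}_n$ is the set of permutations of $[n]$; $\mathbf{w}=(w_k)_{k\ge0}$ are indeterminates. For $\sigma\in\mathfrak{S}_n$ and $i\in[n]$: $i$ is a cycle peak if $\sigma^{-1}(i)<i>\sigma(i)$, a cycle valley if $\sigma^{-1}(i)>i<\sigma(i)$, a cycle double rise if $\sigma^{-1}(i)<i<\sigma(i)$, a cycle double fall if $\sigma^{-1}(i)>i>\sigma(i)$, a fixed point if $\sigma(i)=i$. An index $i$ is a record if $\sigma(j)<\sigma(i)$ for all $j<i$, an antirecord if $\sigma(j)>\sigma(i)$ for all $j>i$; exclusive record = record but not antirecord; exclusive antirecord = antirecord but not record; neither-record-antirecord = neither. eareccpeak (resp. eareccdfall) = number of cycle peaks (resp. cycle double falls) that are exclusive antirecords; ereccval (resp. ereccdrise) = number of cycle valleys (resp. cycle double rises) that are exclusive records; nrcpeak, nrcdfall, nrcval, nrcdrise = numbers of cycle peaks, cycle double falls, cycle valleys, cycle double rises that are neither-record-antirecords; minval = number of cycle valleys that are the smallest element of their cycle; nminval = number of the other cycle valleys. For a fixed point $i$, $\mathrm{psnest}(i,\sigma)=\#\{j<i:\sigma(j)>i\}$. *)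

theory Defs
  imports "HOL-Combinatorics.Permutations" "HOL-Combinatorics.Orbits"
begin

text \<open>
  A permutation of $[n]$ is a function \<open>\<sigma> :: nat \<Rightarrow> nat\<close> with \<open>\<sigma> permutes {1..n}\<close>;
  it is the identity outside \<open>{1..n}\<close>, so every index set below is cut down to \<open>{1..n}\<close>.
\<close>

definition cpeak :: "nat \<Rightarrow> (nat \<Rightarrow> nat) \<Rightarrow> nat set" where
  "cpeak n \<sigma> = {i \<in> {1..n}. inv \<sigma> i < i \<and> i > \<sigma> i}"

definition cval :: "nat \<Rightarrow> (nat \<Rightarrow> nat) \<Rightarrow> nat set" where
  "cval n \<sigma> = {i \<in> {1..n}. inv \<sigma> i > i \<and> i < \<sigma> i}"

definition cdrise :: "nat \<Rightarrow> (nat \<Rightarrow> nat) \<Rightarrow> nat set" where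
  "cdrise n \<sigma> = {i \<in> {1..n}. inv \<sigma> i < i \<and> i < \<sigma> i}"

definition cdfall :: "nat \<Rightarrow> (nat \<Rightarrow> nat) \<Rightarrow> nat set" where
  "cdfall n \<sigma> = {i \<in> {1..n}. inv \<sigma> i > i \<and> i > \<sigma> i}"

definition fixpts :: "nat \<Rightarrow> (nat \<Rightarrow> nat) \<Rightarrow> nat set" where
  "fixpts n \<sigma> = {i \<in> {1..n}. \<sigma> i = i}"

definition records :: "nat \<Rightarrow> (nat \<Rightarrow> nat) \<Rightarrow> nat set" where
  "records n \<sigma> = {i \<in> {1..n}. \<forall>j \<in> {1..n}. j < i \<longrightarrow> \<sigma> j < \<sigma> i}"

definition antirecords :: "nat \<Rightarrow> (nat \<Rightarrow> nat) \<Rightarrow> nat set" where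
  "antirecords n \<sigma> = {i \<in> {1..n}. \<forall>j \<in> {1..n}. j > i \<longrightarrow> \<sigma> j > \<sigma> i}"

definition exclusive_records :: "nat \<Rightarrow> (nat \<Rightarrow> nat) \<Rightarrow> nat set" where
  "exclusive_records n \<sigma> = records n \<sigma> - antirecords n \<sigma>"

definition exclusive_antirecords :: "nat \<Rightarrow> (nat \<Rightarrow> nat) \<Rightarrow> nat set" where
  "exclusive_antirecords n \<sigma> = antirecords n \<sigma> - records n \<sigma>"

definition neither_records :: "nat \<Rightarrow> (nat \<Rightarrow> nat) \<Rightarrow> nat set" where
  "neither_records n \<sigma> = {1..n} - (records n \<sigma> \<union> antirecords n \<sigma>)"

definition eareccpeak :: "nat \<Rightarrow> (nat \<Rightarrow> nat) \<Rightarrow> nat" where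
  "eareccpeak n \<sigma> = card (cpeak n \<sigma> \<inter> exclusive_antirecords n \<sigma>)"

definition eareccdfall :: "nat \<Rightarrow> (nat \<Rightarrow> nat) \<Rightarrow> nat" where
  "eareccdfall n \<sigma> = card (cdfall n \<sigma> \<inter> exclusive_antirecords n \<sigma>)"

definition ereccval :: "nat \<Rightarrow> (nat \<Rightarrow> nat) \<Rightarrow> nat" where
  "ereccval n \<sigma> = card (cval n \<sigma> \<inter> exclusive_records n \<sigma>)"

definition ereccdrise :: "nat \<Rightarrow> (nat \<Rightarrow> nat) \<Rightarrow> nat" where
  "ereccdrise n \<sigma> = card (cdrise n \<sigma> \<inter> exclusive_records n \<sigma>)"

definition nrcpeak :: "nat \<Rightarrow> (nat \<Rightarrow> nat) \<Rightarrow> nat" where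
  "nrcpeak n \<sigma> = card (cpeak n \<sigma> \<inter> neither_records n \<sigma>)"

definition nrcdfall :: "nat \<Rightarrow> (nat \<Rightarrow> nat) \<Rightarrow> nat" where
  "nrcdfall n \<sigma> = card (cdfall n \<sigma> \<inter> neither_records n \<sigma>)"

definition nrcval :: "nat \<Rightarrow> (nat \<Rightarrow> nat) \<Rightarrow> nat" where
  "nrcval n \<sigma> = card (cval n \<sigma> \<inter> neither_records n \<sigma>)"

definition nrcdrise :: "nat \<Rightarrow> (nat \<Rightarrow> nat) \<Rightarrow> nat" where
  "nrcdrise n \<sigma> = card (cdrise n \<sigma> \<inter> neither_records n \<sigma>)"

text \<open>For a permutation of a finite set, \<open>orbit \<sigma> i\<close> is the cycle of \<open>\<sigma>\<close> containing \<open>i\<close>.\<close>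

definition minval :: "nat \<Rightarrow> (nat \<Rightarrow> nat) \<Rightarrow> nat" where
  "minval n \<sigma> = card {i \<in> cval n \<sigma>. \<forall>j \<in> orbit \<sigma> i. i \<le> j}"

definition nminval :: "nat \<Rightarrow> (nat \<Rightarrow> nat) \<Rightarrow> nat" where
  "nminval n \<sigma> = card {i \<in> cval n \<sigma>. \<not> (\<forall>j \<in> orbit \<sigma> i. i \<le> j)}"

definition psnest :: "nat \<Rightarrow> nat \<Rightarrow> (nat \<Rightarrow> nat) \<Rightarrow> nat" where
  "psnest n i \<sigma> = card {j \<in> {1..n}. j < i \<and> \<sigma> j > i}"

definition wfix :: "nat \<Rightarrow> (nat \<Rightarrow> 'a::comm_semiring_1) \<Rightarrow> (nat \<Rightarrow> nat) \<Rightarrow> 'a" where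
  "wfix n w \<sigma> = (\<Prod>i \<in> fixpts n \<sigma>. w (psnest n i \<sigma>))"

text \<open>
  The indeterminates are rendered as arbitrary elements of an arbitrary commutative semiring.
  Identities between the resulting expressions specialise to identities of polynomials (take
  the variables of a polynomial ring), and conversely follow from them by evaluation.
\<close>

definition Qtilde ::
  "nat \<Rightarrow> 'a \<Rightarrow> 'a \<Rightarrow> 'a \<Rightarrow> 'a \<Rightarrow> 'a \<Rightarrow> 'a \<Rightarrow> 'a \<Rightarrow> 'a \<Rightarrow> (nat \<Rightarrow> 'a) \<Rightarrow> 'a::comm_semiring_1" where
  "Qtilde n x1 x2 y1 y2 u1 u2 v1 v2 w =
    (\<Sum>\<sigma> | \<sigma> permutes {1..n}.
      x1 ^ eareccpeak n \<sigma> * x2 ^ eareccdfall n \<sigma> *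
      y1 ^ minval n \<sigma> * y2 ^ ereccdrise n \<sigma> *
      u1 ^ nrcpeak n \<sigma> * u2 ^ nrcdfall n \<sigma> *
      v1 ^ nminval n \<sigma> * v2 ^ nrcdrise n \<sigma> * wfix n w \<sigma>)"

definition Q1 ::
  "nat \<Rightarrow> 'a \<Rightarrow> 'a \<Rightarrow> 'a \<Rightarrow> 'a \<Rightarrow> 'a \<Rightarrow> 'a \<Rightarrow> 'a \<Rightarrow> 'a \<Rightarrow> (nat \<Rightarrow> 'a) \<Rightarrow> 'a::comm_semiring_1" where
  "Q1 n x1 x2 y1 y2 u1 u2 v1 v2 w =
    (\<Sum>\<sigma> | \<sigma> permutes {1..n}.
      x1 ^ eareccpeak n \<sigma> * x2 ^ eareccdfall n \<sigma> *
      y1 ^ ereccval n \<sigma> * y2 ^ ereccdrise n \<sigma> *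
      u1 ^ nrcpeak n \<sigma> * u2 ^ nrcdfall n \<sigma> *
      v1 ^ nrcval n \<sigma> * v2 ^ nrcdrise n \<sigma> * wfix n w \<sigma>)"

end

theory Submission
  imports Defs
begin

text \<open>
  Fix the restriction of \<open>\<sigma>\<close> to its non-excedances, i.e. the indices \<open>i\<close> with \<open>\<sigma> i \<le> i\<close>. It
  determines the type of every index, all statistics of peaks and double falls, and the nesting
  numbers of the fixed points. The permutations with this restriction arise by choosing \<open>\<sigma> k\<close>
  for the excedances \<open>k\<close> in decreasing order; the choices at \<open>k\<close> are the values above \<open>k\<close> not
  taken by larger indices, and their number depends only on the restriction. Exactly one choice,
  the largest value, makes \<open>k\<close> a record. If \<open>k\<close> is a cycle valley, then exactly one choice closes
  a cycle, i.e. makes \<open>k\<close> the minimum of its cycle: walking backwards from \<open>k\<close> one stays above \<open>k\<close>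
  until reaching a value that is still free. So both sums over the fibre equal the same product
  of factors \<open>y + (h - 1) v\<close>, where \<open>h\<close> is the number of choices.
\<close>

section \<open>Permutations with a prescribed restriction to the non-excedances\<close>

text \<open>\<open>None\<close> marks an excedance but hides its value, so lying in one fibre
  becomes an equality of functions.\<close>

definition nonexc_part :: "(nat \<Rightarrow> nat) \<Rightarrow> nat \<Rightarrow> nat option" where
  "nonexc_part \<sigma> = (\<lambda>i. if i < \<sigma> i then None else Some (\<sigma> i))"

text \<open>Members differ from \<open>\<sigma>\<close> only at excedances at most \<open>k\<close>.
  For a permutation \<open>\<sigma>\<close> of \<open>{1..n}\<close>, level \<open>n\<close> is its
  whole fibre and level 0 is \<open>\<sigma>\<close> alone.\<close>

definition completions :: "nat \<Rightarrow> (nat \<Rightarrow> nat) \<Rightarrow> nat \<Rightarrow> (nat \<Rightarrow> nat) set" where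
  "completions n \<sigma> k =
    {\<tau>. \<tau> permutes {1..n} \<and> nonexc_part \<tau> = nonexc_part \<sigma> \<and> (\<forall>j>k. \<tau> j = \<sigma> j)}"

definition avail :: "nat \<Rightarrow> (nat \<Rightarrow> nat) \<Rightarrow> nat \<Rightarrow> nat set" where
  "avail n \<sigma> k = {k<..n} - \<sigma> ` {k<..n}"

lemma nonexc_part_eq_iff:
  "nonexc_part \<tau> = nonexc_part \<sigma> \<longleftrightarrow> (\<forall>i. (i < \<tau> i \<longleftrightarrow> i < \<sigma> i) \<and> (\<sigma> i \<le> i \<longrightarrow> \<tau> i = \<sigma> i))"
proof -
  have "nonexc_part \<tau> i = nonexc_part \<sigma> i \<longleftrightarrow>
      (i < \<tau> i \<longleftrightarrow> i < \<sigma> i) \<and> (\<sigma> i \<le> i \<longrightarrow> \<tau> i = \<sigma> i)" for i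
    by (auto simp: nonexc_part_def)
  then show ?thesis by (simp add: fun_eq_iff)
qed

lemma nonexc_part_exc:
  "nonexc_part \<tau> = nonexc_part \<sigma> \<Longrightarrow> i < \<tau> i \<longleftrightarrow> i < \<sigma> i"
  by (simp add: nonexc_part_eq_iff)

lemma nonexc_part_nonexc:
  "nonexc_part \<tau> = nonexc_part \<sigma> \<Longrightarrow> \<sigma> i \<le> i \<Longrightarrow> \<tau> i = \<sigma> i"
  by (simp add: nonexc_part_eq_iff)

lemma finite_completions: "finite (completions n \<sigma> k)"
  by (rule finite_subset[OF _ finite_permutations[of "{1..n}"]]) (auto simp: completions_def)

lemma permutes_le_iff:
  fixes \<sigma> :: "nat \<Rightarrow> nat"
  assumes "\<sigma> permutes {1..n}"
  shows "\<sigma> i \<le> n \<longleftrightarrow> i \<le> n"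
proof (cases "i = 0")
  case True
  then have "\<sigma> i = i" using permutes_not_in[OF assms, of i] by simp
  then show ?thesis by simp
next
  case False
  then show ?thesis
    using permutes_in_image[OF assms, of i] permutes_not_in[OF assms, of i] by auto
qed

lemma exc_bounds:
  fixes \<sigma> :: "nat \<Rightarrow> nat"
  assumes "\<sigma> permutes {1..n}" "i < \<sigma> i"
  shows "1 \<le> i" "i \<le> n"
  using permutes_not_in[OF assms(1), of i] assms(2) by (cases "i \<in> {1..n}"; simp)+

lemma finite_avail [simp]: "finite (avail n \<sigma> k)"
  by (simp add: avail_def)

text \<open>By injectivity \<open>\<sigma> j\<close> escapes the image of the indices above
  \<open>k\<close> unless \<open>j\<close> is one of them. Thus \<open>avail\<close> lists the ends
  of the arcs that start at or below \<open>k\<close> and end above it.\<close>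

lemma avail_iff:
  assumes "\<sigma> permutes {1..n}"
  shows "\<sigma> j \<in> avail n \<sigma> k \<longleftrightarrow> j \<le> k \<and> k < \<sigma> j"
proof -
  have "\<sigma> j \<in> \<sigma> ` {k<..n} \<longleftrightarrow> j \<in> {k<..n}"
    by (rule inj_image_mem_iff[OF permutes_inj[OF assms]])
  then show ?thesis
    using permutes_le_iff[OF assms, of j] exc_bounds[OF assms, of j] by (auto simp: avail_def)
qed

text \<open>As many arcs leave \<open>{k<..n}\<close> as enter it. The leaving arcs are
  non-excedances, so this count is constant on a fibre.\<close>

lemma card_avail:
  assumes "\<sigma> permutes {1..n}"
  shows "card (avail n \<sigma> k) = card {j \<in> {k<..n}. \<sigma> j \<le> k}"
proof -
  have inj: "inj_on \<sigma> X" for X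
    using permutes_inj[OF assms] by (rule inj_on_subset) simp
  have "card (avail n \<sigma> k) = card {k<..n} - card ({k<..n} \<inter> \<sigma> ` {k<..n})"
    unfolding avail_def by (rule card_Diff_subset_Int) simp
  also have "\<dots> = card (\<sigma> ` {k<..n}) - card (\<sigma> ` {k<..n} \<inter> {k<..n})"
    using card_image[OF inj] by (simp add: Int_commute)
  also have "\<dots> = card (\<sigma> ` {k<..n} - {k<..n})"
    by (rule card_Diff_subset_Int[symmetric]) simp
  also have "\<sigma> ` {k<..n} - {k<..n} = \<sigma> ` {j \<in> {k<..n}. \<sigma> j \<le> k}"
    using permutes_le_iff[OF assms] by force
  finally show ?thesis using card_image[OF inj] by simp
qed

lemma card_avail_cong:
  assumes "\<sigma> permutes {1..n}" "\<tau> permutes {1..n}" "nonexc_part \<tau> = nonexc_part \<sigma>"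
  shows "card (avail n \<tau> k) = card (avail n \<sigma> k)"
proof -
  have "\<tau> j \<le> k \<longleftrightarrow> \<sigma> j \<le> k" if "k < j" for j
    using assms(3) that unfolding nonexc_part_eq_iff
    by (metis linorder_not_le order.strict_trans2 order.asym)
  then have "{j \<in> {k<..n}. \<tau> j \<le> k} = {j \<in> {k<..n}. \<sigma> j \<le> k}" by auto
  then show ?thesis using card_avail assms by metis
qed

lemma avail_completions:
  assumes "\<tau> \<in> completions n \<sigma> k"
  shows "avail n \<tau> k = avail n \<sigma> k"
proof -
  have "\<tau> ` {k<..n} = \<sigma> ` {k<..n}"
    using assms by (intro image_cong) (auto simp: completions_def)
  then show ?thesis by (simp add: avail_def)
qed

text \<open>Fixing the value at \<open>Suc k\<close> leaves a family of the same kind one level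
  down, based at another permutation of the same fibre. In particular every available value
  occurs.\<close>

lemma completions_choice:
  assumes perm: "\<sigma> permutes {1..n}" and exc: "Suc k < \<sigma> (Suc k)"
    and v: "v \<in> avail n \<sigma> (Suc k)"
  obtains \<rho> where "\<rho> permutes {1..n}" "nonexc_part \<rho> = nonexc_part \<sigma>"
    "{\<tau> \<in> completions n \<sigma> (Suc k). \<tau> (Suc k) = v} = completions n \<rho> k"
proof -
  obtain j where j: "v = \<sigma> j" using permutes_surj[OF perm] by blast
  have jk: "j \<le> Suc k" "Suc k < \<sigma> j" using v j avail_iff[OF perm] by auto
  \<comment> \<open>Exchanging the values at \<open>k + 1\<close> and \<open>j\<close> keeps both of them excedances.\<close>
  define \<rho> where "\<rho> = \<sigma> \<circ> transpose (Suc k) j"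
  have mem: "Suc k \<in> {1..n}" "j \<in> {1..n}"
    using exc_bounds[OF perm, of "Suc k"] exc_bounds[OF perm, of j] exc jk by auto
  have \<rho>1: "\<rho> permutes {1..n}" unfolding \<rho>_def
    by (rule permutes_compose[OF permutes_swap_id[OF mem] perm])
  have \<rho>2: "nonexc_part \<rho> = nonexc_part \<sigma>"
    unfolding nonexc_part_eq_iff \<rho>_def using jk exc by (auto simp: transpose_def)
  have \<rho>k: "\<rho> (Suc k) = v" "\<And>i. Suc k < i \<Longrightarrow> \<rho> i = \<sigma> i"
    using jk j by (auto simp: \<rho>_def transpose_def)
  have "{\<tau> \<in> completions n \<sigma> (Suc k). \<tau> (Suc k) = v} = completions n \<rho> k"
    unfolding completions_def \<rho>2 using \<rho>k by (auto, metis Suc_lessI)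
  with \<rho>1 \<rho>2 show ?thesis by (rule that)
qed

section \<open>Summing over a fibre, one excedance at a time\<close>

lemma sum_one_distinguished:
  fixes p q :: "'a::comm_semiring_1"
  assumes "finite A" "s \<in> A"
  shows "(\<Sum>v\<in>A. if v = s then p else q) = p + of_nat (card A - 1) * q"
proof -
  have "(\<Sum>v\<in>A. if v = s then p else q) = p + (\<Sum>v\<in>A - {s}. if v = s then p else q)"
    using assms by (subst sum.remove[of A s]) auto
  also have "(\<Sum>v\<in>A - {s}. if v = s then p else q) = (\<Sum>v\<in>A - {s}. q)"
    by (rule sum.cong) auto
  finally show ?thesis using assms by simp
qed

text \<open>\<open>sp i\<close> may be any property that singles out one of the values available at
  \<open>i\<close>. The right-hand side does not depend on which one, and this makes different
  statistics comparable. Subtracting 1 is safe, since \<open>avail\<close> contains the special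
  value.\<close>

lemma sum_completions:
  fixes a b :: "nat \<Rightarrow> 'a::comm_semiring_1"
  assumes sp: "\<And>\<sigma> k. \<sigma> permutes {1..n} \<Longrightarrow> k < \<sigma> k \<Longrightarrow>
      \<exists>s\<in>avail n \<sigma> k. \<forall>\<tau>\<in>completions n \<sigma> k. sp k \<tau> \<longleftrightarrow> \<tau> k = s"
    and perm: "\<sigma> permutes {1..n}"
  shows "(\<Sum>\<tau>\<in>completions n \<sigma> k. \<Prod>i | i \<in> {1..k} \<and> i < \<sigma> i. if sp i \<tau> then a i else b i) =
    (\<Prod>i | i \<in> {1..k} \<and> i < \<sigma> i. a i + of_nat (card (avail n \<sigma> i) - 1) * b i)"
  using perm
\<comment> \<open>The base permutation varies, since each choice at \<open>Suc k\<close> is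
  continued from its own \<open>\<rho>\<close>.\<close>
proof (induction k arbitrary: \<sigma>)
  case 0
  have "completions n \<sigma> 0 = {\<sigma>}"
  proof -
    have "\<tau> = \<sigma>" if "\<tau> permutes {1..n}" "\<forall>j>0. \<tau> j = \<sigma> j" for \<tau>
    proof
      \<comment> \<open>The index 0 lies outside \<open>{1..n}\<close>, so both permutations fix
        it.\<close>
      fix j show "\<tau> j = \<sigma> j"
        using that permutes_not_in[OF that(1), of 0] permutes_not_in[OF 0, of 0]
        by (cases j) auto
    qed
    then show ?thesis using 0 by (auto simp: completions_def)
  qed
  then show ?case by simp
next
  case (Suc k)
  show ?case
  proof (cases "Suc k < \<sigma> (Suc k)")
    case False
    \<comment> \<open>At a non-excedance the restriction dictates the value, so there is nothing to
      choose.\<close>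
    have "completions n \<sigma> (Suc k) = completions n \<sigma> k"
      unfolding completions_def using False
      by (auto, metis Suc_lessI nonexc_part_nonexc linorder_not_le)
    moreover have "{i. i \<in> {1..Suc k} \<and> i < \<sigma> i} = {i. i \<in> {1..k} \<and> i < \<sigma> i}"
      using False by (auto simp: le_Suc_eq)
    ultimately show ?thesis using Suc.IH[OF Suc.prems] by simp
  next
    case True
    let ?K = "Suc k" and ?J = "{i. i \<in> {1..k} \<and> i < \<sigma> i}"
    let ?f = "\<lambda>i \<tau>. if sp i \<tau> then a i else b i"
    let ?R = "\<Prod>i\<in>?J. a i + of_nat (card (avail n \<sigma> i) - 1) * b i"
    obtain s where s: "s \<in> avail n \<sigma> ?K"
      and sps: "\<And>\<tau>. \<tau> \<in> completions n \<sigma> ?K \<Longrightarrow> sp ?K \<tau> \<longleftrightarrow> \<tau> ?K = s"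
      using sp[OF Suc.prems True] by blast
    have ins: "{i. i \<in> {1..?K} \<and> i < \<sigma> i} = insert ?K ?J"
      using True by auto
    have avail_K: "\<tau> ?K \<in> avail n \<sigma> ?K" if "\<tau> \<in> completions n \<sigma> ?K" for \<tau>
    proof -
      have t: "\<tau> permutes {1..n}" "?K < \<tau> ?K"
        using that True nonexc_part_exc[of \<tau> \<sigma> ?K] by (auto simp: completions_def)
      then show ?thesis using avail_iff[OF t(1)] avail_completions[OF that] by auto
    qed
    \<comment> \<open>Once the value at \<open>?K\<close> is fixed, its factor is constant and the
      induction hypothesis for \<open>\<rho>\<close> evaluates the rest. The result
      \<open>?R\<close> is the same for every \<open>v\<close>, because the numbers of choices agree
      on the fibre.\<close>
    have inner: "(\<Sum>\<tau> | \<tau> \<in> completions n \<sigma> ?K \<and> \<tau> ?K = v. ?f ?K \<tau> * (\<Prod>i\<in>?J. ?f i \<tau>)) =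
        (if v = s then a ?K else b ?K) * ?R" if v: "v \<in> avail n \<sigma> ?K" for v
    proof -
      obtain \<rho> where \<rho>: "\<rho> permutes {1..n}" "nonexc_part \<rho> = nonexc_part \<sigma>"
        "{\<tau> \<in> completions n \<sigma> ?K. \<tau> ?K = v} = completions n \<rho> k"
        using completions_choice[OF Suc.prems True v] by blast
      have J: "?J = {i. i \<in> {1..k} \<and> i < \<rho> i}"
        using nonexc_part_exc[OF \<rho>(2)] by auto
      have "(\<Sum>\<tau> | \<tau> \<in> completions n \<sigma> ?K \<and> \<tau> ?K = v. ?f ?K \<tau> * (\<Prod>i\<in>?J. ?f i \<tau>)) =
          (\<Sum>\<tau> | \<tau> \<in> completions n \<sigma> ?K \<and> \<tau> ?K = v.
            (if v = s then a ?K else b ?K) * (\<Prod>i\<in>?J. ?f i \<tau>))"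
        by (rule sum.cong) (auto simp: sps)
      also have "\<dots> = (if v = s then a ?K else b ?K) * (\<Sum>\<tau>\<in>completions n \<rho> k. \<Prod>i\<in>?J. ?f i \<tau>)"
        unfolding \<rho>(3) sum_distrib_left ..
      also have "(\<Sum>\<tau>\<in>completions n \<rho> k. \<Prod>i\<in>?J. ?f i \<tau>) = ?R"
        unfolding J Suc.IH[OF \<rho>(1)] card_avail_cong[OF Suc.prems \<rho>(1,2)] ..
      finally show ?thesis .
    qed
    have "(\<Sum>\<tau>\<in>completions n \<sigma> ?K. \<Prod>i | i \<in> {1..?K} \<and> i < \<sigma> i. ?f i \<tau>) =
        (\<Sum>\<tau>\<in>completions n \<sigma> ?K. ?f ?K \<tau> * (\<Prod>i\<in>?J. ?f i \<tau>))"
      unfolding ins by (subst prod.insert) auto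
    also have "\<dots> = (\<Sum>v\<in>avail n \<sigma> ?K.
        \<Sum>\<tau> | \<tau> \<in> completions n \<sigma> ?K \<and> \<tau> ?K = v. ?f ?K \<tau> * (\<Prod>i\<in>?J. ?f i \<tau>))"
      by (rule sum.group[symmetric]) (use avail_K finite_completions in auto)
    also have "\<dots> = (\<Sum>v\<in>avail n \<sigma> ?K. (if v = s then a ?K else b ?K) * ?R)"
      using inner by (intro sum.cong) auto
    also have "\<dots> = (a ?K + of_nat (card (avail n \<sigma> ?K) - 1) * b ?K) * ?R"
      by (simp only: sum_distrib_right[symmetric] sum_one_distinguished[OF finite_avail s])
    also have "\<dots> = (\<Prod>i | i \<in> {1..?K} \<and> i < \<sigma> i. a i + of_nat (card (avail n \<sigma> i) - 1) * b i)"
      unfolding ins by (subst prod.insert) auto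
    finally show ?thesis .
  qed
qed

section \<open>Choices that create a record or close a cycle\<close>

text \<open>Earlier values at most \<open>k\<close> lie below \<open>\<tau> k\<close> anyway, and
  the earlier values above \<open>k\<close> are available ones. So the special value is the maximum
  of \<open>avail\<close>.\<close>

lemma record_choice:
  assumes perm: "\<sigma> permutes {1..n}" and exc: "k < \<sigma> k"
  shows "\<exists>s\<in>avail n \<sigma> k. \<forall>\<tau>\<in>completions n \<sigma> k. k \<in> records n \<tau> \<longleftrightarrow> \<tau> k = s"
proof (intro bexI ballI)
  have ne: "avail n \<sigma> k \<noteq> {}" using avail_iff[OF perm, of k k] exc by auto
  then show "Max (avail n \<sigma> k) \<in> avail n \<sigma> k" by (rule Max_in[OF finite_avail])
  fix \<tau> assume \<tau>: "\<tau> \<in> completions n \<sigma> k"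
  then have t: "\<tau> permutes {1..n}" "k < \<tau> k"
    using exc nonexc_part_exc[of \<tau> \<sigma> k] by (auto simp: completions_def)
  have kn: "k \<in> {1..n}" using exc_bounds[OF perm exc] by simp
  have k_avail: "\<tau> k \<in> avail n \<sigma> k"
    using avail_iff[OF t(1), of k k] t(2) avail_completions[OF \<tau>] by simp
  have "k \<in> records n \<tau> \<longleftrightarrow> (\<forall>v\<in>avail n \<sigma> k. v \<le> \<tau> k)"
  proof
    assume rec: "k \<in> records n \<tau>"
    show "\<forall>v\<in>avail n \<sigma> k. v \<le> \<tau> k"
    proof
      fix v assume v: "v \<in> avail n \<sigma> k"
      obtain j where j: "v = \<tau> j" using permutes_surj[OF t(1)] by blast
      have "j \<le> k" "k < \<tau> j" using v j avail_iff[OF t(1), of j k] avail_completions[OF \<tau>] by auto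
      then show "v \<le> \<tau> k"
        using rec exc_bounds[OF t(1), of j] unfolding records_def j
        by (cases "j = k") (auto intro: less_imp_le)
    qed
  next
    assume max: "\<forall>v\<in>avail n \<sigma> k. v \<le> \<tau> k"
    have "\<tau> j < \<tau> k" if "j < k" for j
    proof (cases "\<tau> j \<le> k")
      case True then show ?thesis using t(2) by simp
    next
      case False
      then have "\<tau> j \<in> avail n \<sigma> k"
        using that avail_iff[OF t(1), of j k] avail_completions[OF \<tau>] by simp
      moreover have "\<tau> j \<noteq> \<tau> k" using that permutes_inj[OF t(1)] by (auto dest: injD)
      ultimately show ?thesis using max by (simp add: le_neq_implies_less)
    qed
    then show "k \<in> records n \<tau>" using kn by (simp add: records_def)
  qed
  also have "\<dots> \<longleftrightarrow> \<tau> k = Max (avail n \<sigma> k)"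
    using Max_eq_iff[OF finite_avail ne, of "\<tau> k"] k_avail by metis
  finally show "k \<in> records n \<tau> \<longleftrightarrow> \<tau> k = Max (avail n \<sigma> k)" .
qed

text \<open>Before reaching \<open>k\<close> the path stays above \<open>k\<close>, so every
  permutation that agrees with \<open>\<sigma>\<close> above \<open>k\<close> follows it too. Its
  start is the image of an index at most \<open>k\<close>, hence available.\<close>

lemma orbit_return_path:
  assumes perm: "\<sigma> permutes {1..n}" and inv: "k < inv \<sigma> k"
  obtains s p where "s \<in> avail n \<sigma> k" "(\<sigma> ^^ p) s = k" "\<And>r. r < p \<Longrightarrow> k < (\<sigma> ^^ r) s"
proof -
  have "permutation \<sigma>" using perm permutation_permutes by blast
  then have "k \<in> orbit \<sigma> k" by (rule permutation_self_in_orbit)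
  then obtain N where N: "N > 0" "(\<sigma> ^^ N) k = k" by (auto simp: orbit_altdef)
  \<comment> \<open>The last visit at or below \<open>k\<close> before the cycle returns to \<open>k\<close>; the path starts one step later.\<close>
  define q where "q = Max {q \<in> {..<N}. (\<sigma> ^^ q) k \<le> k}"
  have fin: "finite {q \<in> {..<N}. (\<sigma> ^^ q) k \<le> k}" by simp
  have "0 \<in> {q \<in> {..<N}. (\<sigma> ^^ q) k \<le> k}" using N by simp
  then have "q \<in> {q \<in> {..<N}. (\<sigma> ^^ q) k \<le> k}"
    unfolding q_def by (intro Max_in[OF fin]) blast
  then have q: "q < N" "(\<sigma> ^^ q) k \<le> k" by auto
  have qmax: "k < (\<sigma> ^^ r) k" if "q < r" "r < N" for r
    using Max_ge[OF fin, of r] that unfolding q_def[symmetric] by (force simp: not_le[symmetric])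
  define s where "s = (\<sigma> ^^ Suc q) k"
  define p where "p = N - Suc q"
  have shift: "(\<sigma> ^^ r) s = (\<sigma> ^^ (r + Suc q)) k" for r
    unfolding s_def funpow_add by simp
  have end_eq: "(\<sigma> ^^ p) s = k" using N q unfolding shift p_def by simp
  have path: "k < (\<sigma> ^^ r) s" if "r < p" for r
    unfolding shift by (rule qmax) (use that p_def in auto)
  \<comment> \<open>The assumption on \<open>inv \<sigma> k\<close> enters here: an empty path would
    put the preimage of \<open>k\<close> at or below \<open>k\<close>.\<close>
  have "p \<noteq> 0"
  proof
    assume "p = 0"
    then have "\<sigma> ((\<sigma> ^^ q) k) = k" using end_eq s_def by simp
    then have "inv \<sigma> k = (\<sigma> ^^ q) k" using permutes_inverses(2)[OF perm] by metis
    then show False using q inv by simp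
  qed
  then have "k < s" using path[of 0] by simp
  then have "s \<in> avail n \<sigma> k" using q avail_iff[OF perm] by (simp add: s_def)
  then show ?thesis using end_eq path by (rule that)
qed

text \<open>Here and in \<open>inv_less_iff\<close> the position of the preimage of \<open>i\<close>
  is expressed by arcs into \<open>i\<close> from indices at least \<open>i\<close>. Such arcs are
  non-excedances, hence visible in \<open>nonexc_part\<close>.\<close>

lemma less_inv_iff:
  fixes \<rho> :: "nat \<Rightarrow> nat"
  assumes "\<rho> permutes {1..n}"
  shows "i < inv \<rho> i \<longleftrightarrow> (\<exists>j>i. \<rho> j = i)"
  using permutes_inverses[OF assms] by metis

lemma inv_less_iff:
  fixes \<rho> :: "nat \<Rightarrow> nat"
  assumes "\<rho> permutes {1..n}"
  shows "inv \<rho> i < i \<longleftrightarrow> \<not> (\<exists>j\<ge>i. \<rho> j = i)"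
  using permutes_inverses[OF assms] by (metis linorder_not_le)

lemma cval_cong:
  assumes "\<sigma> permutes {1..n}" "\<tau> permutes {1..n}" "nonexc_part \<tau> = nonexc_part \<sigma>"
  shows "cval n \<tau> = cval n \<sigma>"
proof -
  have "(\<exists>j>i. \<tau> j = i) \<longleftrightarrow> (\<exists>j>i. \<sigma> j = i)" for i
    using assms(3) unfolding nonexc_part_eq_iff by (metis linorder_not_le order.asym)
  then show ?thesis
    unfolding cval_def less_inv_iff[OF assms(1)] less_inv_iff[OF assms(2)] using nonexc_part_exc[OF assms(3)] by auto
qed

text \<open>The special value is the start \<open>s\<close> of the return path. Choosing it closes a
  cycle whose other points exceed \<open>k\<close>. Otherwise some index below \<open>k\<close> is
  sent to \<open>s\<close>, and the path puts that index on the cycle of \<open>k\<close>.\<close>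

lemma cycle_minimum_choice:
  assumes perm: "\<sigma> permutes {1..n}" and val: "k \<in> cval n \<sigma>"
  shows "\<exists>s\<in>avail n \<sigma> k. \<forall>\<tau>\<in>completions n \<sigma> k. (\<forall>j\<in>orbit \<tau> k. k \<le> j) \<longleftrightarrow> \<tau> k = s"
proof -
  have "k < inv \<sigma> k" using val by (simp add: cval_def)
  then obtain s p where s: "s \<in> avail n \<sigma> k" and p: "(\<sigma> ^^ p) s = k"
    and path: "\<And>r. r < p \<Longrightarrow> k < (\<sigma> ^^ r) s"
    using orbit_return_path[OF perm] by blast
  have "(\<forall>j\<in>orbit \<tau> k. k \<le> j) \<longleftrightarrow> \<tau> k = s" if \<tau>: "\<tau> \<in> completions n \<sigma> k" for \<tau>
  proof
    have t: "\<tau> permutes {1..n}" using \<tau> by (simp add: completions_def)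
    assume min: "\<forall>j\<in>orbit \<tau> k. k \<le> j"
    \<comment> \<open>The points of the path before \<open>k\<close> lie above \<open>k\<close>,
      where \<open>\<tau>\<close> and \<open>\<sigma>\<close> agree.\<close>
    have same: "(\<tau> ^^ r) s = (\<sigma> ^^ r) s" if "r \<le> p" for r
      using that
    proof (induction r)
      case (Suc r)
      then show ?case using path[of r] \<tau> by (simp add: completions_def)
    qed simp
    obtain u where u: "\<tau> u = s" using permutes_surj[OF t] by (metis surjD)
    have uk: "u \<le> k" using s u avail_iff[OF t] avail_completions[OF \<tau>] by auto
    have "(\<tau> ^^ Suc p) u = k" using same[of p] p u by (simp add: funpow_Suc_right del: funpow.simps)
    then have "k \<in> orbit \<tau> u" unfolding orbit_altdef by (metis (mono_tags, lifting) mem_Collect_eq zero_less_Suc)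
    moreover have "permutation \<tau>" using t permutation_permutes by blast
    ultimately have "u \<in> orbit \<tau> k" by (meson orbit_swap permutation_self_in_orbit)
    then show "\<tau> k = s" using min uk u by auto
  next
    assume k: "\<tau> k = s"
    \<comment> \<open>The point \<open>k\<close> together with the path is closed under
      \<open>\<tau>\<close>, hence contains the orbit of \<open>k\<close>.\<close>
    have closed: "\<tau> x = k \<or> (\<exists>r<p. \<tau> x = (\<sigma> ^^ r) s)" if "x = k \<or> (\<exists>r<p. x = (\<sigma> ^^ r) s)" for x
      using that
    proof
      assume "x = k"
      then show ?thesis using k p by (cases p) force+
    next
      assume "\<exists>r<p. x = (\<sigma> ^^ r) s"
      then obtain r where r: "r < p" "x = (\<sigma> ^^ r) s" by blast
      then have "\<tau> x = (\<sigma> ^^ Suc r) s" using path[of r] \<tau> by (simp add: completions_def)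
      moreover have "Suc r = p \<or> Suc r < p" using r by auto
      ultimately show ?thesis using p by blast
    qed
    show "\<forall>j\<in>orbit \<tau> k. k \<le> j"
    proof
      fix j assume "j \<in> orbit \<tau> k"
      then have "j = k \<or> (\<exists>r<p. j = (\<sigma> ^^ r) s)"
        by (induction rule: orbit.induct) (use closed in blast)+
      then show "k \<le> j" using path by (auto intro: less_imp_le)
    qed
  qed
  with s show ?thesis by blast
qed

section \<open>Statistics that are constant on a fibre\<close>

text \<open>Pigeonhole: the \<open>i - 1\<close> earlier values are distinct and lie in
  \<open>{1..<\<sigma> i}\<close>.\<close>

lemma record_imp_weak_exc:
  assumes perm: "\<sigma> permutes {1..n}" and "i \<in> records n \<sigma>"
  shows "i \<le> \<sigma> i"
proof -
  have i: "i \<in> {1..n}" and rec: "\<And>j. j \<in> {1..n} \<Longrightarrow> j < i \<Longrightarrow> \<sigma> j < \<sigma> i"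
    using assms(2) by (auto simp: records_def)
  have "\<sigma> ` {1..<i} \<subseteq> {1..<\<sigma> i}"
    using rec i permutes_in_image[OF perm] by fastforce
  then have "card (\<sigma> ` {1..<i}) \<le> card {1..<\<sigma> i}" by (intro card_mono) auto
  moreover have "card (\<sigma> ` {1..<i}) = card {1..<i}"
    by (rule card_image) (rule inj_on_subset[OF permutes_inj[OF perm]], simp)
  moreover have "1 \<le> \<sigma> i" using i permutes_in_image[OF perm, of i] by simp
  ultimately show ?thesis using i by simp
qed

text \<open>Dually, the \<open>n - i\<close> later values are distinct and lie in
  \<open>{\<sigma> i<..n}\<close>.\<close>

lemma antirecord_imp_weak_anti_exc:
  assumes perm: "\<sigma> permutes {1..n}" and "i \<in> antirecords n \<sigma>"
  shows "\<sigma> i \<le> i"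
proof -
  have i: "i \<in> {1..n}" and rec: "\<And>j. j \<in> {1..n} \<Longrightarrow> i < j \<Longrightarrow> \<sigma> i < \<sigma> j"
    using assms(2) by (auto simp: antirecords_def)
  have "\<sigma> ` {i<..n} \<subseteq> {\<sigma> i<..n}"
    using rec permutes_le_iff[OF perm] by fastforce
  then have "card (\<sigma> ` {i<..n}) \<le> card {\<sigma> i<..n}" by (intro card_mono) auto
  moreover have "card (\<sigma> ` {i<..n}) = card {i<..n}"
    by (rule card_image) (rule inj_on_subset[OF permutes_inj[OF perm]], simp)
  moreover have "\<sigma> i \<le> n" using i permutes_le_iff[OF perm, of i] by simp
  ultimately show ?thesis using i by simp
qed

text \<open>A later excedance has a value beyond \<open>i\<close>, hence above
  \<open>\<sigma> i\<close>, in both permutations. The remaining comparisons involve only shared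
  values.\<close>

lemma antirecord_cong:
  assumes "\<sigma> permutes {1..n}" "\<tau> permutes {1..n}" and eq: "nonexc_part \<tau> = nonexc_part \<sigma>"
    and "\<sigma> i < i"
  shows "i \<in> antirecords n \<tau> \<longleftrightarrow> i \<in> antirecords n \<sigma>"
proof -
  have ti: "\<tau> i = \<sigma> i" using nonexc_part_nonexc[OF eq, of i] assms(4) by simp
  have "\<sigma> i < \<tau> j \<longleftrightarrow> \<sigma> i < \<sigma> j" if "i < j" for j
    using nonexc_part_nonexc[OF eq, of j] nonexc_part_exc[OF eq, of j] that assms(4)
    by (cases "\<sigma> j \<le> j") auto
  then show ?thesis by (auto simp: antirecords_def ti)
qed

text \<open>A fixed point is not an excedance, so all arcs counted by \<open>avail\<close> start
  strictly before \<open>i\<close>. With \<open>card_avail_cong\<close> this makes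
  \<open>psnest\<close> constant on a fibre.\<close>

lemma psnest_fixpt:
  assumes perm: "\<sigma> permutes {1..n}" and fp: "\<sigma> i = i"
  shows "psnest n i \<sigma> = card (avail n \<sigma> i)"
proof -
  have "avail n \<sigma> i = \<sigma> ` {j \<in> {1..n}. j < i \<and> i < \<sigma> j}"
  proof (intro equalityI subsetI)
    fix v assume v: "v \<in> avail n \<sigma> i"
    obtain j where j: "v = \<sigma> j" using permutes_surj[OF perm] by blast
    have "j \<le> i" "i < \<sigma> j" using v j avail_iff[OF perm] by auto
    then show "v \<in> \<sigma> ` {j \<in> {1..n}. j < i \<and> i < \<sigma> j}"
      using fp exc_bounds[OF perm, of j] j by (cases "j = i") auto
  next
    fix v assume "v \<in> \<sigma> ` {j \<in> {1..n}. j < i \<and> i < \<sigma> j}"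
    then show "v \<in> avail n \<sigma> i" using avail_iff[OF perm] by auto
  qed
  then show ?thesis
    unfolding psnest_def
    by (simp add: card_image[OF inj_on_subset[OF permutes_inj[OF perm]]])
qed

lemma fixpts_cong:
  assumes "nonexc_part \<tau> = nonexc_part \<sigma>"
  shows "fixpts n \<tau> = fixpts n \<sigma>"
proof -
  have "\<tau> i = i \<longleftrightarrow> \<sigma> i = i" for i
    using nonexc_part_nonexc[OF assms, of i] nonexc_part_exc[OF assms, of i]
    by (cases "\<sigma> i \<le> i") auto
  then show ?thesis by (simp add: fixpts_def)
qed

lemma wfix_cong:
  assumes "\<sigma> permutes {1..n}" "\<tau> permutes {1..n}" "nonexc_part \<tau> = nonexc_part \<sigma>"
  shows "wfix n w \<tau> = wfix n w \<sigma>"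
  unfolding wfix_def
proof (rule prod.cong)
  show "fixpts n \<tau> = fixpts n \<sigma>" by (rule fixpts_cong[OF assms(3)])
  fix i assume i: "i \<in> fixpts n \<sigma>"
  then have "\<tau> i = i" "\<sigma> i = i" using fixpts_cong[OF assms(3)] by (auto simp: fixpts_def)
  then show "w (psnest n i \<tau>) = w (psnest n i \<sigma>)"
    using psnest_fixpt assms(1,2) card_avail_cong[OF assms] by metis
qed

lemma cpeak_cdfall_cong:
  assumes "\<sigma> permutes {1..n}" "\<tau> permutes {1..n}" and eq: "nonexc_part \<tau> = nonexc_part \<sigma>"
  shows "cpeak n \<tau> = cpeak n \<sigma>" "cdfall n \<tau> = cdfall n \<sigma>"
proof -
  have "(\<exists>j\<ge>i. \<tau> j = i) \<longleftrightarrow> (\<exists>j\<ge>i. \<sigma> j = i)" "(\<exists>j>i. \<tau> j = i) \<longleftrightarrow> (\<exists>j>i. \<sigma> j = i)" for i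
    using eq unfolding nonexc_part_eq_iff by (metis linorder_not_le order.asym)+
  moreover have "\<tau> i < i \<longleftrightarrow> \<sigma> i < i" for i
    using nonexc_part_nonexc[OF eq, of i] nonexc_part_exc[OF eq, of i] by (cases "\<sigma> i \<le> i") auto
  ultimately show "cpeak n \<tau> = cpeak n \<sigma>" "cdfall n \<tau> = cdfall n \<sigma>"
    unfolding cpeak_def cdfall_def less_inv_iff[OF assms(1)] less_inv_iff[OF assms(2)]
      inv_less_iff[OF assms(1)] inv_less_iff[OF assms(2)] by auto
qed

text \<open>An index with \<open>\<sigma> i < i\<close> is never a record, so for peaks and double
  falls only the antirecord condition matters, and the fibre determines it.\<close>

lemma fall_statistics_cong:
  assumes "\<sigma> permutes {1..n}" "\<tau> permutes {1..n}" and eq: "nonexc_part \<tau> = nonexc_part \<sigma>"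
  shows "eareccpeak n \<tau> = eareccpeak n \<sigma>" "eareccdfall n \<tau> = eareccdfall n \<sigma>"
    "nrcpeak n \<tau> = nrcpeak n \<sigma>" "nrcdfall n \<tau> = nrcdfall n \<sigma>"
proof -
  have fall: "\<sigma> i < i" if "i \<in> cpeak n \<sigma> \<or> i \<in> cdfall n \<sigma>" for i
    using that by (auto simp: cpeak_def cdfall_def)
  have no_rec: "i \<notin> records n \<sigma>" "i \<notin> records n \<tau>" if "\<sigma> i < i" for i
    using record_imp_weak_exc[OF assms(1), of i] record_imp_weak_exc[OF assms(2), of i]
      nonexc_part_nonexc[OF eq, of i] that by auto
  have E: "i \<in> exclusive_antirecords n \<tau> \<longleftrightarrow> i \<in> exclusive_antirecords n \<sigma>"
    and N: "i \<in> neither_records n \<tau> \<longleftrightarrow> i \<in> neither_records n \<sigma>"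
    if "i \<in> cpeak n \<sigma> \<or> i \<in> cdfall n \<sigma>" for i
    using no_rec[OF fall[OF that]] antirecord_cong[OF assms fall[OF that]]
    by (auto simp: exclusive_antirecords_def neither_records_def)
  show "eareccpeak n \<tau> = eareccpeak n \<sigma>" "eareccdfall n \<tau> = eareccdfall n \<sigma>"
    unfolding eareccpeak_def eareccdfall_def cpeak_cdfall_cong[OF assms]
    by (rule arg_cong[where f = card], use E in blast)+
  show "nrcpeak n \<tau> = nrcpeak n \<sigma>" "nrcdfall n \<tau> = nrcdfall n \<sigma>"
    unfolding nrcpeak_def nrcdfall_def cpeak_cdfall_cong[OF assms]
    by (rule arg_cong[where f = card], use N in blast)+
qed

section \<open>Weights carried by the excedances\<close>

lemma prod_if_card:
  fixes p q :: "'a::comm_monoid_mult"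
  assumes "finite A"
  shows "(\<Prod>i\<in>A. if P i then p else q) = p ^ card {i \<in> A. P i} * q ^ card {i \<in> A. \<not> P i}"
  using assms by (simp add: prod.If_cases Int_def Collect_conj_eq[symmetric] Compl_eq)

text \<open>The preimage of an excedance is larger or smaller than it, so excedances split into
  cycle valleys and double rises. \<open>P\<close> stays open to serve both records and cycle
  minima.\<close>

lemma excedance_product:
  fixes y1 y2 v1 v2 :: "'a::comm_semiring_1"
  assumes perm: "\<sigma> permutes {1..n}"
  shows "(\<Prod>i | i \<in> {1..n} \<and> i < \<sigma> i.
      if P i then (if i \<in> cval n \<sigma> then y1 else y2) else (if i \<in> cval n \<sigma> then v1 else v2)) =
    y1 ^ card {i \<in> cval n \<sigma>. P i} * v1 ^ card {i \<in> cval n \<sigma>. \<not> P i} *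
    (y2 ^ card {i \<in> cdrise n \<sigma>. P i} * v2 ^ card {i \<in> cdrise n \<sigma>. \<not> P i})"
proof -
  have ne: "inv \<sigma> i \<noteq> i" if "i < \<sigma> i" for i
    using permutes_inverses(1)[OF perm, of i] that by auto
  have split: "{i. i \<in> {1..n} \<and> i < \<sigma> i} = cval n \<sigma> \<union> cdrise n \<sigma>"
    using ne by (auto simp: cval_def cdrise_def neq_iff)
  have disj: "cval n \<sigma> \<inter> cdrise n \<sigma> = {}" by (auto simp: cval_def cdrise_def)
  have fin: "finite (cval n \<sigma>)" "finite (cdrise n \<sigma>)" by (auto simp: cval_def cdrise_def)
  show ?thesis
    unfolding split prod.union_disjoint[OF fin disj]
      prod_if_card[OF fin(1), symmetric] prod_if_card[OF fin(2), symmetric]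
    by (intro arg_cong2[where f = "(*)"] prod.cong) (use disj in auto)
qed

text \<open>An excedance is never an antirecord, by
  \<open>antirecord_imp_weak_anti_exc\<close>.\<close>

lemma exclusive_record_exc_iff:
  assumes "\<sigma> permutes {1..n}" "i < \<sigma> i"
  shows "i \<in> exclusive_records n \<sigma> \<longleftrightarrow> i \<in> records n \<sigma>"
    "i \<in> neither_records n \<sigma> \<longleftrightarrow> i \<notin> records n \<sigma>"
  using antirecord_imp_weak_anti_exc[OF assms(1), of i] assms(2) exc_bounds[OF assms]
  by (auto simp: exclusive_records_def neither_records_def)

lemma rise_statistics:
  assumes "\<sigma> permutes {1..n}"
  shows "ereccval n \<sigma> = card {i \<in> cval n \<sigma>. i \<in> records n \<sigma>}"
    "nrcval n \<sigma> = card {i \<in> cval n \<sigma>. i \<notin> records n \<sigma>}"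
    "ereccdrise n \<sigma> = card {i \<in> cdrise n \<sigma>. i \<in> records n \<sigma>}"
    "nrcdrise n \<sigma> = card {i \<in> cdrise n \<sigma>. i \<notin> records n \<sigma>}"
  unfolding ereccval_def nrcval_def ereccdrise_def nrcdrise_def
  by (rule arg_cong[where f = card],
      use exclusive_record_exc_iff[OF assms] in \<open>auto simp: cval_def cdrise_def\<close>)+

section \<open>Comparison of the two sums\<close>

text \<open>The mixed criterion behind \<open>Qtilde\<close>: there \<open>y1\<close> marks cycle
  minima among the valleys, while \<open>y2\<close> still marks records among the double
  rises.\<close>

definition distinguished :: "nat \<Rightarrow> nat \<Rightarrow> (nat \<Rightarrow> nat) \<Rightarrow> bool" where
  "distinguished n i \<sigma> \<longleftrightarrow> (if i \<in> cval n \<sigma> then \<forall>j\<in>orbit \<sigma> i. i \<le> j else i \<in> records n \<sigma>)"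

text \<open>All completions have the same cycle valleys, so the same clause of
  \<open>distinguished\<close> applies to each of them at \<open>k\<close>.\<close>

lemma distinguished_choice:
  assumes perm: "\<sigma> permutes {1..n}" and exc: "k < \<sigma> k"
  shows "\<exists>s\<in>avail n \<sigma> k. \<forall>\<tau>\<in>completions n \<sigma> k. distinguished n k \<tau> \<longleftrightarrow> \<tau> k = s"
proof -
  have "cval n \<tau> = cval n \<sigma>" if "\<tau> \<in> completions n \<sigma> k" for \<tau>
    using that cval_cong[OF perm] by (auto simp: completions_def)
  then show ?thesis
    using record_choice[OF assms] cycle_minimum_choice[OF perm, of k]
    unfolding distinguished_def by (cases "k \<in> cval n \<sigma>") auto
qed

theorem theorem3:
  fixes n :: nat
    and x1 x2 y1 y2 u1 u2 v1 v2 :: "'a::comm_semiring_1"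
    and w :: "nat \<Rightarrow> 'a"
  shows "Qtilde n x1 x2 y1 y2 u1 u2 v1 v2 w = Q1 n x1 x2 y1 y2 u1 u2 v1 v2 w"
proof -
  let ?S = "{\<sigma>. \<sigma> permutes {1..n}}"
  \<comment> \<open>\<open>C\<close> gathers the factors that are constant on a fibre,
    \<open>W\<close> those decided at the excedances.\<close>
  define C where "C \<sigma> = x1 ^ eareccpeak n \<sigma> * x2 ^ eareccdfall n \<sigma> * u1 ^ nrcpeak n \<sigma> *
    u2 ^ nrcdfall n \<sigma> * wfix n w \<sigma>" for \<sigma>
  define W where "W sp \<sigma> = (\<Prod>i | i \<in> {1..n} \<and> i < \<sigma> i.
      if sp i \<sigma> then (if i \<in> cval n \<sigma> then y1 else y2) else (if i \<in> cval n \<sigma> then v1 else v2))"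
    for sp :: "nat \<Rightarrow> (nat \<Rightarrow> nat) \<Rightarrow> bool" and \<sigma>
  let ?rec = "\<lambda>i \<sigma>. i \<in> records n \<sigma>"
  \<comment> \<open>The right-hand side is free of \<open>sp\<close>, so both criteria give the same
    sum over a fibre.\<close>
  have fibre: "(\<Sum>\<tau>\<in>completions n \<sigma> n. C \<tau> * W sp \<tau>) = C \<sigma> *
      (\<Prod>i | i \<in> {1..n} \<and> i < \<sigma> i. (if i \<in> cval n \<sigma> then y1 else y2) +
        of_nat (card (avail n \<sigma> i) - 1) * (if i \<in> cval n \<sigma> then v1 else v2))"
    if perm: "\<sigma> permutes {1..n}"
      and sp: "\<And>\<sigma> k. \<sigma> permutes {1..n} \<Longrightarrow> k < \<sigma> k \<Longrightarrow>
        \<exists>s\<in>avail n \<sigma> k. \<forall>\<tau>\<in>completions n \<sigma> k. sp k \<tau> \<longleftrightarrow> \<tau> k = s" for \<sigma> sp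
  proof -
    have "C \<tau> * W sp \<tau> = C \<sigma> * (\<Prod>i | i \<in> {1..n} \<and> i < \<sigma> i.
        if sp i \<tau> then (if i \<in> cval n \<sigma> then y1 else y2) else (if i \<in> cval n \<sigma> then v1 else v2))"
      if "\<tau> \<in> completions n \<sigma> n" for \<tau>
    proof -
      have t: "\<tau> permutes {1..n}" "nonexc_part \<tau> = nonexc_part \<sigma>"
        using that by (auto simp: completions_def)
      show ?thesis
        unfolding C_def W_def fall_statistics_cong[OF perm t] wfix_cong[OF perm t]
          cval_cong[OF perm t] nonexc_part_exc[OF t(2)] ..
    qed
    then show ?thesis
      using sum_completions[of n sp \<sigma> "\<lambda>i. if i \<in> cval n \<sigma> then y1 else y2"
          "\<lambda>i. if i \<in> cval n \<sigma> then v1 else v2" n] sp perm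
      by (simp add: sum_distrib_left[symmetric])
  qed
  have fibre_eq: "{\<tau> \<in> ?S. nonexc_part \<tau> = nonexc_part \<sigma>} = completions n \<sigma> n"
    if "\<sigma> permutes {1..n}" for \<sigma>
  proof -
    have "\<tau> j = \<sigma> j" if "\<tau> permutes {1..n}" "n < j" for \<tau> j
      using permutes_not_in[OF that(1), of j] permutes_not_in[OF \<open>\<sigma> permutes {1..n}\<close>, of j] that(2)
      by simp
    then show ?thesis by (auto simp: completions_def)
  qed
  have total: "(\<Sum>\<sigma>\<in>?S. C \<sigma> * W (distinguished n) \<sigma>) = (\<Sum>\<sigma>\<in>?S. C \<sigma> * W ?rec \<sigma>)"
  proof -
    have fin: "finite ?S" by (rule finite_permutations) simp
    \<comment> \<open>The sums are compared fibre by fibre, \<open>f\<close> being the common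
      restriction.\<close>
    have "(\<Sum>\<tau> | \<tau> \<in> ?S \<and> nonexc_part \<tau> = f. C \<tau> * W (distinguished n) \<tau>) =
        (\<Sum>\<tau> | \<tau> \<in> ?S \<and> nonexc_part \<tau> = f. C \<tau> * W ?rec \<tau>)" if f: "f \<in> nonexc_part ` ?S" for f
    proof -
      obtain \<sigma> where \<sigma>: "\<sigma> permutes {1..n}" "f = nonexc_part \<sigma>" using f by blast
      show ?thesis
        unfolding \<sigma>(2) fibre_eq[OF \<sigma>(1)]
        by (rule trans[OF fibre[OF \<sigma>(1)] fibre[OF \<sigma>(1), symmetric]])
          (rule distinguished_choice record_choice; assumption)+
    qed
    then show ?thesis
      unfolding sum.image_gen[OF fin, of _ nonexc_part] by (rule sum.cong[OF refl])
  qed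
  have "Q1 n x1 x2 y1 y2 u1 u2 v1 v2 w = (\<Sum>\<sigma>\<in>?S. C \<sigma> * W ?rec \<sigma>)"
    unfolding Q1_def
  proof (rule sum.cong[OF refl])
    fix \<sigma> assume "\<sigma> \<in> ?S"
    then have perm: "\<sigma> permutes {1..n}" by simp
    show "x1 ^ eareccpeak n \<sigma> * x2 ^ eareccdfall n \<sigma> * y1 ^ ereccval n \<sigma> * y2 ^ ereccdrise n \<sigma> *
        u1 ^ nrcpeak n \<sigma> * u2 ^ nrcdfall n \<sigma> * v1 ^ nrcval n \<sigma> * v2 ^ nrcdrise n \<sigma> * wfix n w \<sigma> =
        C \<sigma> * W ?rec \<sigma>"
      unfolding C_def W_def excedance_product[OF perm] rise_statistics[OF perm]
      by (simp only: ac_simps)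
  qed
  moreover have "Qtilde n x1 x2 y1 y2 u1 u2 v1 v2 w = (\<Sum>\<sigma>\<in>?S. C \<sigma> * W (distinguished n) \<sigma>)"
    unfolding Qtilde_def
  proof (rule sum.cong[OF refl])
    fix \<sigma> assume "\<sigma> \<in> ?S"
    then have perm: "\<sigma> permutes {1..n}" by simp
    have "{i \<in> cval n \<sigma>. distinguished n i \<sigma>} = {i \<in> cval n \<sigma>. \<forall>j\<in>orbit \<sigma> i. i \<le> j}"
      "{i \<in> cval n \<sigma>. \<not> distinguished n i \<sigma>} = {i \<in> cval n \<sigma>. \<not> (\<forall>j\<in>orbit \<sigma> i. i \<le> j)}"
      by (auto simp: distinguished_def)
    \<comment> \<open>Double rises are not cycle valleys, so only the record clause of
      \<open>distinguished\<close> applies.\<close>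
    moreover have "{i \<in> cdrise n \<sigma>. distinguished n i \<sigma>} = {i \<in> cdrise n \<sigma>. i \<in> records n \<sigma>}"
      "{i \<in> cdrise n \<sigma>. \<not> distinguished n i \<sigma>} = {i \<in> cdrise n \<sigma>. i \<notin> records n \<sigma>}"
      by (auto simp: distinguished_def cval_def cdrise_def)
    ultimately show "x1 ^ eareccpeak n \<sigma> * x2 ^ eareccdfall n \<sigma> * y1 ^ minval n \<sigma> * y2 ^ ereccdrise n \<sigma> *
        u1 ^ nrcpeak n \<sigma> * u2 ^ nrcdfall n \<sigma> * v1 ^ nminval n \<sigma> * v2 ^ nrcdrise n \<sigma> * wfix n w \<sigma> =
        C \<sigma> * W (distinguished n) \<sigma>"
      unfolding C_def W_def excedance_product[OF perm] rise_statistics[OF perm] minval_def nminval_def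
      by (simp only: ac_simps)
  qed
  ultimately show ?thesis using total by simp
qed

end
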